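(* Let $\mathcal{P}=(p_{ij})$ be the (column-)stochastic matrix of an irreducible finite Markov chain with $n$ states indexed by $i=1,2,\dots,n$, with invariant distribution $\pi=(\pi_i)$ and associated fundamental matrix $Z$. Then, given an initial probability distribution $x=(x_i)$, the mean time $\tau(x\to j)$ to reach the state $j$ is given by $$\tau(x\to j)=1+\frac{Z_{jj}-(Z\mathcal{P}x)_j}{\pi_j}.$$
   Context: Stochastic matrices act on column vectors: $p_{ij}\ge0$ is the probability of a one-step transition from state $j$ to state $i$, so each column of $\mathcal{P}$ sums to 1, and a distribution $x$ (column vector with $x_i\ge0$, $\sum_i x_i=1$) evolves as $x\mapsto\mathcal{P}x$. Irreducible means that any state can be reached from any other with positive probability in some number of steps. The invariant distribution $\pi$ is the unique probability vector with $\mathcal{P}\pi=\pi$; it has $\pi_i>0$ for all $i$. The fundamental matrix is $Z=(I-\mathcal{P}+\Omega)^{-1}$, where $I$ is the $n\times n$ identity matrix and $\Omega=\pi\mathbf{1}^T$ is the matrix all of whose columns equal $\pi$ (this inverse exists). For a chain $(X_r)_{r\ge0}$ with $X_0$ distributed according to $x$, $\tau(x\to j)$ is the expected value of $\min\{r\ge1: X_r=j\}$ (the time of first visit counted from step 1 on, so that starting at $j$ it is the return time to $j$). *)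

theory Defs
  imports "HOL-Probability.Probability"
begin

text \<open>
  Matrices act on column vectors: \<open>P $ i $ j\<close> is the probability of a one-step transition
  from state \<open>j\<close> to state \<open>i\<close>. The state space is a finite index type \<open>'n\<close>.
\<close>

definition prob_vector :: "real ^ 'n \<Rightarrow> bool" where
  "prob_vector x \<longleftrightarrow> (\<forall>i. 0 \<le> x $ i) \<and> (\<Sum>i\<in>UNIV. x $ i) = 1"

definition column_stochastic :: "real ^ 'n ^ 'n \<Rightarrow> bool" where
  "column_stochastic P \<longleftrightarrow>
     (\<forall>i j. 0 \<le> P $ i $ j) \<and> (\<forall>j. (\<Sum>i\<in>UNIV. P $ i $ j) = 1)"

text \<open>The operation \<open>^\<close> on \<open>real ^ 'n ^ 'n\<close> would be the entrywise power.\<close>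

primrec matrix_pow :: "real ^ 'n ^ 'n \<Rightarrow> nat \<Rightarrow> real ^ 'n ^ 'n" where
  "matrix_pow P 0 = mat 1"
| "matrix_pow P (Suc k) = P ** matrix_pow P k"

definition irreducible_chain :: "real ^ 'n ^ 'n \<Rightarrow> bool" where
  "irreducible_chain P \<longleftrightarrow> (\<forall>i j. i \<noteq> j \<longrightarrow> (\<exists>k. 0 < matrix_pow P k $ i $ j))"

definition invariant_distribution :: "real ^ 'n ^ 'n \<Rightarrow> real ^ 'n \<Rightarrow> bool" where
  "invariant_distribution P \<pi> \<longleftrightarrow> prob_vector \<pi> \<and> P *v \<pi> = \<pi>"

definition fundamental_matrix :: "real ^ 'n ^ 'n \<Rightarrow> real ^ 'n \<Rightarrow> real ^ 'n ^ 'n" where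
  "fundamental_matrix P \<pi> = matrix_inv (mat 1 - P + (\<chi> i j. \<pi> $ i))"

text \<open>
  The transition law is conditional on the whole history \<open>s 0, \<dots>, s r\<close>, so it comprises both the
  Markov property and time homogeneity.
\<close>

definition markov_chain ::
    "'a measure \<Rightarrow> (nat \<Rightarrow> 'a \<Rightarrow> 'n) \<Rightarrow> real ^ 'n ^ 'n \<Rightarrow> real ^ 'n \<Rightarrow> bool" where
  "markov_chain M X P x \<longleftrightarrow>
     prob_space M \<and>
     (\<forall>r. X r \<in> measurable M (count_space UNIV)) \<and>
     (\<forall>i. \<P>(\<omega> in M. X 0 \<omega> = i) = x $ i) \<and>
     (\<forall>r s i. 0 < \<P>(\<omega> in M. \<forall>k\<le>r. X k \<omega> = s k) \<longrightarrow>
        \<P>(\<omega> in M. X (Suc r) \<omega> = i \<bar> \<forall>k\<le>r. X k \<omega> = s k) = P $ i $ s r)"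

text \<open>The infimum is \<open>\<infinity>\<close> if \<open>j\<close> is never visited at a time \<open>r \<ge> 1\<close>.\<close>

definition first_visit_time :: "(nat \<Rightarrow> 'a \<Rightarrow> 'n) \<Rightarrow> 'n \<Rightarrow> 'a \<Rightarrow> enat" where
  "first_visit_time X j \<omega> = (INF r\<in>{r. 1 \<le> r \<and> X r \<omega> = j}. enat r)"

definition mean_first_visit_time :: "'a measure \<Rightarrow> (nat \<Rightarrow> 'a \<Rightarrow> 'n) \<Rightarrow> 'n \<Rightarrow> ennreal" where
  "mean_first_visit_time M X j = (\<integral>\<^sup>+\<omega>. ennreal_of_enat (first_visit_time X j \<omega>) \<partial>M)"

end

theory Submission
  imports Defs
begin

text \<open>
  Let \<open>y\<^sub>r\<close> be the law of \<open>X\<^sub>r\<close> restricted to the event that \<open>j\<close> is not visited at the times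
  \<open>1, \<dots>, r\<close>, so that \<open>\<P>(T > r) = \<Sum>\<^sub>i y\<^sub>r(i)\<close>. Since \<open>Z (I - P) = I - \<Omega>\<close>, the row vector
  \<open>h\<^sub>i = 1 + (Z\<^sub>j\<^sub>j - (Z P)\<^sub>j\<^sub>i) / \<pi>\<^sub>j\<close> satisfies \<open>h y\<^sub>r = \<Sum>\<^sub>i y\<^sub>r(i) + h y\<^sub>r\<^sub>+\<^sub>1\<close>, and the tail probabilities
  telescope. The \<open>y\<^sub>r\<close> are bounded, hence so are the partial sums of the tail probabilities;
  thus the tail probabilities tend to \<open>0\<close>, so \<open>h y\<^sub>r \<rightarrow> 0\<close> and the sum is \<open>h x\<close>.
\<close>

section \<open>Invariant vectors of irreducible matrices\<close>

lemma matrix_pow_nonneg: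
  assumes "column_stochastic P"
  shows "0 \<le> matrix_pow P k $ i $ l"
  using assms
  by (induction k arbitrary: i l)
     (auto simp: mat_def matrix_matrix_mult_def column_stochastic_def intro!: sum_nonneg)

lemma matrix_pow_fixed:
  assumes "P *v u = u"
  shows "matrix_pow P k *v u = u"
  by (induction k) (simp_all add: assms flip: matrix_vector_mul_assoc)

text \<open>Since \<open>u\<close> is fixed by every power of \<open>P\<close>, the zero entry
  \<open>u $ i\<close> is a sum of nonnegative terms, all of which must vanish. Irreducibility
  supplies, for each \<open>l\<close>, a power whose coefficient of \<open>u $ l\<close> is
  positive.\<close>

lemma irreducible_nonneg_fixed_eq_0:
  fixes P :: "real ^ 'n ^ 'n" and u :: "real ^ 'n"
  assumes P: "column_stochastic P" and irr: "irreducible_chain P"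
    and fixed: "P *v u = u" and nonneg: "\<And>i. 0 \<le> u $ i" and zero: "u $ i = 0"
  shows "u = 0"
proof -
  have "u $ l = 0" if l: "l \<noteq> i" for l
  proof -
    obtain k where k: "0 < matrix_pow P k $ i $ l"
      using irr l unfolding irreducible_chain_def by metis
    have "(\<Sum>m\<in>UNIV. matrix_pow P k $ i $ m * u $ m) = (matrix_pow P k *v u) $ i"
      by (simp add: matrix_vector_mult_def)
    also have "\<dots> = 0"
      by (simp add: matrix_pow_fixed fixed zero)
    finally have "matrix_pow P k $ i $ l * u $ l = 0"
      by (subst (asm) sum_nonneg_eq_0_iff) (auto simp: matrix_pow_nonneg P nonneg)
    then show ?thesis using k by simp
  qed
  then show ?thesis using zero by (metis vec_eq_iff zero_index)
qed

lemma invariant_distribution_pos: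
  assumes "column_stochastic P" "irreducible_chain P" "invariant_distribution P \<pi>"
  shows "0 < \<pi> $ i"
proof (rule ccontr)
  assume "\<not> 0 < \<pi> $ i"
  moreover have nonneg: "0 \<le> \<pi> $ l" and fixed: "P *v \<pi> = \<pi>" for l
    using assms(3) by (simp_all add: invariant_distribution_def prob_vector_def)
  ultimately have "\<pi> $ i = 0"
    by (meson antisym not_less)
  then have "\<pi> = 0"
    using irreducible_nonneg_fixed_eq_0[OF assms(1,2) fixed nonneg] by blast
  then show False
    using assms by (simp add: invariant_distribution_def prob_vector_def)
qed

text \<open>Subtracting the largest multiple of \<open>\<pi>\<close> that leaves \<open>v\<close>
  nonnegative gives a fixed vector with a zero entry, where the minimal ratio is attained. Such a
  vector is 0.\<close>

lemma fixed_vector_proportional: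
  fixes P :: "real ^ 'n ^ 'n"
  assumes P: "column_stochastic P" and irr: "irreducible_chain P"
    and inv: "invariant_distribution P \<pi>" and fixed: "P *v v = v"
  obtains c where "v = c *s \<pi>"
proof -
  have pos: "0 < \<pi> $ i" for i
    using assms invariant_distribution_pos by blast
  define c where "c = Min (range (\<lambda>i. v $ i / \<pi> $ i))"
  have "c \<in> range (\<lambda>i. v $ i / \<pi> $ i)"
    unfolding c_def by (rule Min_in) auto
  then obtain i where i: "c = v $ i / \<pi> $ i" by blast
  have le: "c \<le> v $ l / \<pi> $ l" for l
    unfolding c_def by (rule Min_le) auto
  have "v - c *s \<pi> = 0"
  proof (rule irreducible_nonneg_fixed_eq_0[OF P irr])
    show "P *v (v - c *s \<pi>) = v - c *s \<pi>"
      using inv fixed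
      by (simp add: matrix_vector_mult_diff_distrib vector_scalar_commute invariant_distribution_def)
    show "0 \<le> (v - c *s \<pi>) $ l" for l
      using le[of l] pos[of l] by (simp add: pos_le_divide_eq)
    show "(v - c *s \<pi>) $ i = 0"
      using i pos[of i] by simp
  qed
  then have "v = c *s \<pi>" by simp
  then show thesis by (rule that)
qed

section \<open>The fundamental matrix\<close>

lemma sum_column_stochastic_mult:
  assumes "column_stochastic P"
  shows "(\<Sum>i\<in>UNIV. (P *v v) $ i) = (\<Sum>i\<in>UNIV. v $ i)"
proof -
  have "(\<Sum>i\<in>UNIV. (P *v v) $ i) = (\<Sum>l\<in>UNIV. \<Sum>i\<in>UNIV. P $ i $ l * v $ l)"
    unfolding matrix_vector_mult_def by (simp, rule sum.swap)
  then show ?thesis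
    using assms by (simp add: column_stochastic_def flip: sum_distrib_right)
qed

lemma const_column_mult:
  fixes \<pi> v :: "real ^ 'n"
  shows "(\<chi> i j. \<pi> $ i) *v v = (\<Sum>i\<in>UNIV. v $ i) *s \<pi>"
  by (simp add: vec_eq_iff matrix_vector_mult_def mult.commute flip: sum_distrib_left)

text \<open>The argument of \<open>Z\<close> is \<open>A *v v\<close> with \<open>A\<close> the
  matrix being inverted. If \<open>A *v w = 0\<close>, summing entries gives \<open>w\<close> total
  0, because \<open>P\<close> preserves totals. Then \<open>w\<close> is fixed by \<open>P\<close>,
  hence a multiple of \<open>\<pi>\<close> with total 0, so \<open>w = 0\<close> and
  \<open>A\<close> is invertible.\<close>

lemma fundamental_matrix_inverse:
  fixes P :: "real ^ 'n ^ 'n"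
  assumes P: "column_stochastic P" and irr: "irreducible_chain P"
    and inv: "invariant_distribution P \<pi>"
  shows "fundamental_matrix P \<pi> *v (v - P *v v + (\<Sum>i\<in>UNIV. v $ i) *s \<pi>) = v"
proof -
  define A where "A = mat 1 - P + (\<chi> i j. \<pi> $ i)"
  have A: "A *v w = w - P *v w + (\<Sum>i\<in>UNIV. w $ i) *s \<pi>" for w
    by (simp add: A_def matrix_vector_mult_add_rdistrib matrix_vector_mult_diff_rdistrib
        const_column_mult)
  have sum\<pi>: "(\<Sum>i\<in>UNIV. \<pi> $ i) = 1"
    using inv by (simp add: invariant_distribution_def prob_vector_def)
  have "w = 0" if "A *v w = 0" for w
  proof -
    have "0 = (\<Sum>i\<in>UNIV. (A *v w) $ i)"
      using that by simp
    also have "\<dots> = (\<Sum>i\<in>UNIV. w $ i)"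
      by (simp add: A sum.distrib sum_subtractf sum_column_stochastic_mult P sum\<pi>
          flip: sum_distrib_left)
    finally have sum0: "(\<Sum>i\<in>UNIV. w $ i) = 0" by simp
    with that have "P *v w = w" by (simp add: A)
    then obtain c where c: "w = c *s \<pi>"
      using fixed_vector_proportional[OF P irr inv] by blast
    with sum0 have "c = 0" by (simp add: sum\<pi> flip: sum_distrib_left)
    with c show ?thesis by simp
  qed
  then have "invertible A"
    by (metis invertible_left_inverse matrix_left_invertible_ker)
  \<comment> \<open>\<open>matrix_inv\<close> is a choice term, so its defining property has to be
    drawn from the existence of a two-sided inverse.\<close>
  then have "fundamental_matrix P \<pi> ** A = mat 1"
    unfolding fundamental_matrix_def A_def[symmetric] invertible_def matrix_inv_def
    using someI_ex[of "\<lambda>B. A ** B = mat 1 \<and> B ** A = mat 1"] by blast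
  then show ?thesis
    by (metis A matrix_vector_mul_assoc matrix_vector_mul_lid)
qed

lemma fundamental_matrix_invariant:
  assumes "column_stochastic P" "irreducible_chain P" "invariant_distribution P \<pi>"
  shows "fundamental_matrix P \<pi> *v \<pi> = \<pi>"
  using fundamental_matrix_inverse[OF assms, of \<pi>] assms(3)
  by (simp add: invariant_distribution_def prob_vector_def)

text \<open>This is Z(I - P) = I - \<Omega> applied to \<open>v\<close>; it follows from the inverse
  property because Z fixes \<open>\<pi>\<close>.\<close>

lemma fundamental_matrix_Poisson:
  assumes "column_stochastic P" "irreducible_chain P" "invariant_distribution P \<pi>"
  shows "fundamental_matrix P \<pi> *v v - fundamental_matrix P \<pi> *v (P *v v) =
           v - (\<Sum>i\<in>UNIV. v $ i) *s \<pi>"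
  using fundamental_matrix_inverse[OF assms, of v]
  by (simp add: matrix_vector_mult_diff_distrib matrix_vector_right_distrib
      vector_scalar_commute fundamental_matrix_invariant[OF assms] algebra_simps)

section \<open>Distributions before the first visit\<close>

text \<open>These are taboo probabilities with taboo state \<open>j\<close>. The mass of
  \<open>x\<close> at \<open>j\<close> is kept at time 0, since visits count only from step 1
  on.\<close>

primrec unvisited_dist :: "real ^ 'n ^ 'n \<Rightarrow> real ^ 'n \<Rightarrow> 'n \<Rightarrow> nat \<Rightarrow> real ^ 'n" where
  "unvisited_dist P x j 0 = x"
| "unvisited_dist P x j (Suc r) =
     (\<chi> i. if i = j then 0 else (P *v unvisited_dist P x j r) $ i)"

lemma unvisited_dist_nonneg:
  assumes "column_stochastic P" "\<And>i. 0 \<le> x $ i"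
  shows "0 \<le> unvisited_dist P x j r $ i"
  using assms
  by (induction r arbitrary: i)
     (auto simp: matrix_vector_mult_def column_stochastic_def intro!: sum_nonneg)

text \<open>The product form also covers paths of probability 0, about which the conditional law
  says nothing: there both sides vanish.\<close>

lemma markov_chain_path_step:
  assumes "markov_chain M X P x"
  shows "\<P>(\<omega> in M. (\<forall>k\<le>r. X k \<omega> = s k) \<and> X (Suc r) \<omega> = i) =
           P $ i $ s r * \<P>(\<omega> in M. \<forall>k\<le>r. X k \<omega> = s k)"
proof (cases "\<P>(\<omega> in M. \<forall>k\<le>r. X k \<omega> = s k) = 0")
  case True
  interpret prob_space M using assms by (simp add: markov_chain_def)
  have [measurable]: "\<And>r. X r \<in> measurable M (count_space UNIV)"
    using assms by (simp add: markov_chain_def)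
  have "\<P>(\<omega> in M. (\<forall>k\<le>r. X k \<omega> = s k) \<and> X (Suc r) \<omega> = i) \<le> \<P>(\<omega> in M. \<forall>k\<le>r. X k \<omega> = s k)"
    by (rule finite_measure_mono) auto
  then show ?thesis using True by (simp add: measure_le_0_iff)
next
  case False
  then have pos: "0 < \<P>(\<omega> in M. \<forall>k\<le>r. X k \<omega> = s k)"
    by (simp add: zero_less_measure_iff)
  then have "\<P>(\<omega> in M. X (Suc r) \<omega> = i \<bar> \<forall>k\<le>r. X k \<omega> = s k) = P $ i $ s r"
    using assms by (simp add: markov_chain_def)
  then show ?thesis
    using pos by (simp add: cond_prob_def field_simps conj_commute)
qed

lemma (in prob_space) prob_split_finite:
  assumes "finite I" "\<And>\<omega>. \<omega> \<in> space M \<Longrightarrow> f \<omega> \<in> I"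
    and "\<And>i. i \<in> I \<Longrightarrow> {\<omega>\<in>space M. Q \<omega> \<and> f \<omega> = i} \<in> events"
  shows "\<P>(\<omega> in M. Q \<omega>) = (\<Sum>i\<in>I. \<P>(\<omega> in M. Q \<omega> \<and> f \<omega> = i))"
proof -
  have "{\<omega>\<in>space M. Q \<omega>} = (\<Union>i\<in>I. {\<omega>\<in>space M. Q \<omega> \<and> f \<omega> = i})"
    using assms(2) by auto
  then show ?thesis
    using assms by (simp, subst finite_measure_finite_Union)
      (auto simp: disjoint_family_on_def)
qed

text \<open>An event determined by the times up to \<open>r\<close> splits into finitely many paths.
  On each path the transition law depends only on the last state, so paths can be regrouped by that
  state.\<close>

lemma markov_chain_step:
  fixes X :: "nat \<Rightarrow> 'a \<Rightarrow> 'n::finite"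
  assumes mc: "markov_chain M X P x"
    and Q: "\<And>s s'. (\<forall>k\<le>r. s k = s' k) \<Longrightarrow> Q s \<longleftrightarrow> Q s'"
  shows "\<P>(\<omega> in M. Q (\<lambda>k. X k \<omega>) \<and> X (Suc r) \<omega> = i) =
           (\<Sum>l\<in>UNIV. P $ i $ l * \<P>(\<omega> in M. Q (\<lambda>k. X k \<omega>) \<and> X r \<omega> = l))"
proof -
  interpret prob_space M using mc by (simp add: markov_chain_def)
  have X [measurable]: "\<And>r. X r \<in> measurable M (count_space UNIV)"
    using mc by (simp add: markov_chain_def)
  \<comment> \<open>Extensional functions make the set of paths finite. Their default value beyond
    \<open>r\<close> is harmless because \<open>Q\<close> looks only at times up to
    \<open>r\<close>.\<close>
  define S where "S = {..r} \<rightarrow>\<^sub>E (UNIV :: 'n set)"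
  define path where "path \<omega> = (\<lambda>k\<in>{..r}. X k \<omega>)" for \<omega>
  define p where "p s = \<P>(\<omega> in M. \<forall>k\<le>r. X k \<omega> = s k)" for s
  have fin: "finite S"
    unfolding S_def by (simp add: finite_PiE)
  have path_eq: "path \<omega> = s \<longleftrightarrow> (\<forall>k\<le>r. X k \<omega> = s k)" if "s \<in> S" for s \<omega>
    using that unfolding S_def path_def by (auto simp: fun_eq_iff PiE_iff extensional_def)
  have Q_path: "Q (\<lambda>k. X k \<omega>) \<longleftrightarrow> Q s" if "\<forall>k\<le>r. X k \<omega> = s k" for s \<omega>
    using that by (intro Q) simp
  \<comment> \<open>The event \<open>R\<close> stays general so that it can be both
    \<open>X r \<omega> = l\<close> and \<open>X (Suc r) \<omega> = i\<close>.\<close>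
  have split: "\<P>(\<omega> in M. Q (\<lambda>k. X k \<omega>) \<and> R \<omega>) =
      (\<Sum>s\<in>S. if Q s then \<P>(\<omega> in M. (\<forall>k\<le>r. X k \<omega> = s k) \<and> R \<omega>) else 0)"
    if [measurable]: "Measurable.pred M R" for R
  proof -
    have eq: "{\<omega>\<in>space M. (Q (\<lambda>k. X k \<omega>) \<and> R \<omega>) \<and> path \<omega> = s} =
        (if Q s then {\<omega>\<in>space M. (\<forall>k\<le>r. X k \<omega> = s k) \<and> R \<omega>} else {})" if "s \<in> S" for s
      using Q_path by (auto simp: path_eq[OF that])
    have "\<P>(\<omega> in M. Q (\<lambda>k. X k \<omega>) \<and> R \<omega>) =
        (\<Sum>s\<in>S. \<P>(\<omega> in M. (Q (\<lambda>k. X k \<omega>) \<and> R \<omega>) \<and> path \<omega> = s))"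
    proof (rule prob_split_finite[OF fin])
      show "path \<omega> \<in> S" for \<omega>
        by (simp add: path_def S_def)
      show "{\<omega>\<in>space M. (Q (\<lambda>k. X k \<omega>) \<and> R \<omega>) \<and> path \<omega> = s} \<in> events" if "s \<in> S" for s
        unfolding eq[OF that] by auto
    qed
    also have "\<dots> = (\<Sum>s\<in>S. if Q s then \<P>(\<omega> in M. (\<forall>k\<le>r. X k \<omega> = s k) \<and> R \<omega>) else 0)"
      by (rule sum.cong[OF refl], subst eq) simp_all
    finally show ?thesis .
  qed
  have last: "\<P>(\<omega> in M. (\<forall>k\<le>r. X k \<omega> = s k) \<and> X r \<omega> = l) = (if s r = l then p s else 0)" for s l
  proof -
    have "{\<omega>\<in>space M. (\<forall>k\<le>r. X k \<omega> = s k) \<and> X r \<omega> = l} =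
        (if s r = l then {\<omega>\<in>space M. \<forall>k\<le>r. X k \<omega> = s k} else {})"
      by auto
    then show ?thesis by (simp add: p_def)
  qed
  have "(\<Sum>l\<in>UNIV. P $ i $ l * \<P>(\<omega> in M. Q (\<lambda>k. X k \<omega>) \<and> X r \<omega> = l)) =
      (\<Sum>l\<in>UNIV. \<Sum>s\<in>S. P $ i $ l * (if Q s then if s r = l then p s else 0 else 0))"
    by (subst split) (simp_all add: last sum_distrib_left cong: if_cong)
  also have "\<dots> = (\<Sum>s\<in>S. \<Sum>l\<in>UNIV. if s r = l then P $ i $ l * (if Q s then p s else 0) else 0)"
    by (subst sum.swap) (auto intro!: sum.cong)
  also have "\<dots> = (\<Sum>s\<in>S. P $ i $ s r * (if Q s then p s else 0))"
    by simp
  also have "\<dots> = \<P>(\<omega> in M. Q (\<lambda>k. X k \<omega>) \<and> X (Suc r) \<omega> = i)"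
    by (subst split) (auto simp: markov_chain_path_step[OF mc] p_def intro!: sum.cong)
  finally show ?thesis by simp
qed

lemma prob_unvisited:
  fixes X :: "nat \<Rightarrow> 'a \<Rightarrow> 'n::finite"
  assumes mc: "markov_chain M X P x"
  shows "\<P>(\<omega> in M. (\<forall>k\<in>{1..r}. X k \<omega> \<noteq> j) \<and> X r \<omega> = i) = unvisited_dist P x j r $ i"
proof (induction r arbitrary: i)
  case 0
  then show ?case using mc by (simp add: markov_chain_def)
next
  case (Suc r)
  have "{\<omega>\<in>space M. (\<forall>k\<in>{1..Suc r}. X k \<omega> \<noteq> j) \<and> X (Suc r) \<omega> = i} =
      (if i = j then {} else {\<omega>\<in>space M. (\<forall>k\<in>{1..r}. X k \<omega> \<noteq> j) \<and> X (Suc r) \<omega> = i})"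
    by (auto simp: atLeastAtMostSuc_conv)
  moreover have "\<P>(\<omega> in M. (\<forall>k\<in>{1..r}. X k \<omega> \<noteq> j) \<and> X (Suc r) \<omega> = i) =
      (\<Sum>l\<in>UNIV. P $ i $ l * \<P>(\<omega> in M. (\<forall>k\<in>{1..r}. X k \<omega> \<noteq> j) \<and> X r \<omega> = l))"
    by (rule markov_chain_step[OF mc, where Q = "\<lambda>s. \<forall>k\<in>{1..r}. s k \<noteq> j"]) auto
  ultimately show ?case
    by (simp add: Suc.IH matrix_vector_mult_def del: One_nat_def)
qed

section \<open>Tails, measurability and mean of the first visit time\<close>

lemma less_first_visit_time_iff:
  "enat r < first_visit_time X j \<omega> \<longleftrightarrow> (\<forall>k\<in>{1..r}. X k \<omega> \<noteq> j)"
proof -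
  have "enat r < first_visit_time X j \<omega> \<longleftrightarrow> enat (Suc r) \<le> first_visit_time X j \<omega>"
    by (simp add: Suc_ile_eq)
  also have "\<dots> \<longleftrightarrow> (\<forall>k. 1 \<le> k \<and> X k \<omega> = j \<longrightarrow> Suc r \<le> k)"
    by (simp add: first_visit_time_def le_INF_iff)
  also have "\<dots> \<longleftrightarrow> (\<forall>k\<in>{1..r}. X k \<omega> \<noteq> j)"
    by (auto simp: not_less_eq_eq)
  finally show ?thesis .
qed

lemma measurable_first_visit_time:
  assumes [measurable]: "\<And>r. X r \<in> measurable M (count_space UNIV)"
  shows "first_visit_time X j \<in> measurable M (count_space UNIV)"
proof -
  \<comment> \<open>The index set depends on \<open>\<omega>\<close>; padding with \<infinity> turns
    it into a countable infimum over a fixed index set.\<close>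
  have "first_visit_time X j = (\<lambda>\<omega>. INF r. if 1 \<le> r \<and> X r \<omega> = j then enat r else \<infinity>)"
  proof (rule ext, rule antisym)
    fix \<omega>
    show "first_visit_time X j \<omega> \<le> (INF r. if 1 \<le> r \<and> X r \<omega> = j then enat r else \<infinity>)"
      unfolding first_visit_time_def by (rule INF_greatest) (auto intro: INF_lower)
    show "(INF r. if 1 \<le> r \<and> X r \<omega> = j then enat r else \<infinity>) \<le> first_visit_time X j \<omega>"
      unfolding first_visit_time_def by (rule INF_mono) auto
  qed
  then show ?thesis by (simp only:) measurable
qed

lemma mean_first_visit_time_eq_suminf:
  fixes X :: "nat \<Rightarrow> 'a \<Rightarrow> 'n::finite"
  assumes mc: "markov_chain M X P x"
  shows "mean_first_visit_time M X j =
           (\<Sum>r. ennreal (\<Sum>i\<in>UNIV. unvisited_dist P x j r $ i))"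
proof -
  interpret prob_space M using mc by (simp add: markov_chain_def)
  have X [measurable]: "\<And>r. X r \<in> measurable M (count_space UNIV)"
    using mc by (simp add: markov_chain_def)
  have "\<P>(\<omega> in M. \<forall>k\<in>{1..r}. X k \<omega> \<noteq> j) = (\<Sum>i\<in>UNIV. unvisited_dist P x j r $ i)" for r
    unfolding prob_unvisited[OF mc, symmetric]
    by (rule prob_split_finite) auto
  then show ?thesis
    by (simp add: mean_first_visit_time_def nn_integral_enat_function measurable_first_visit_time
        less_first_visit_time_iff emeasure_eq_measure)
qed

section \<open>Summing the tail probabilities\<close>

text \<open>Finiteness of the mean is a conclusion here: the remainder \<open>h (y N)\<close> of the
  telescoping sum is first bounded, which gives summability, and only then shown to vanish.\<close>

lemma sums_unvisited_dist:
  fixes P :: "real ^ 'n ^ 'n" and h :: "real ^ 'n \<Rightarrow> real"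
  assumes P: "column_stochastic P" and x: "\<And>i. 0 \<le> x $ i" and h: "linear h"
    and step: "\<And>r. h (unvisited_dist P x j r) =
      (\<Sum>i\<in>UNIV. unvisited_dist P x j r $ i) + h (unvisited_dist P x j (Suc r))"
  shows "(\<lambda>r. \<Sum>i\<in>UNIV. unvisited_dist P x j r $ i) sums h x"
proof -
  define y where "y = unvisited_dist P x j"
  define t where "t r = (\<Sum>i\<in>UNIV. y r $ i)" for r
  have y_nonneg: "0 \<le> y r $ i" for r i
    unfolding y_def using unvisited_dist_nonneg[OF P x] .
  then have t_nonneg: "0 \<le> t r" for r
    by (simp add: t_def sum_nonneg)
  have y_le: "y r $ i \<le> t r" for r i
    unfolding t_def by (rule member_le_sum) (auto simp: y_nonneg)
  have partial: "(\<Sum>r<N. t r) = h x - h (y N)" for N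
    by (induction N) (use step in \<open>auto simp: y_def t_def\<close>)
  \<comment> \<open>A step of \<open>P\<close> preserves total mass, and the mass arriving at
    \<open>j\<close> is then discarded.\<close>
  have "t (Suc r) \<le> t r" for r
  proof -
    have "t (Suc r) \<le> (\<Sum>i\<in>UNIV. (P *v y r) $ i)"
      unfolding t_def using P y_nonneg
      by (intro sum_mono)
         (auto simp: y_def matrix_vector_mult_def column_stochastic_def intro!: sum_nonneg)
    then show ?thesis
      by (simp add: sum_column_stochastic_mult[OF P] t_def)
  qed
  then have t_le: "t r \<le> t 0" for r
    by (metis decseq_Suc_iff decseqD le0)
  obtain B where B: "\<And>v. norm (h v) \<le> B * norm v" "B > 0"
    using linear_bounded_pos[OF h] by (metis mult.commute)
  have norm_y: "norm (y r) \<le> t r" for r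
    using norm_le_l1_cart[of "y r"] y_nonneg by (simp add: t_def)
  have h_le: "norm (h (y r)) \<le> B * t r" for r
    using B(1)[of "y r"] norm_y[of r] B(2) by (meson mult_left_mono order.trans less_imp_le)
  have "(\<Sum>r<N. t r) \<le> h x + B * t 0" for N
  proof -
    have "- h (y N) \<le> B * t N" using h_le[of N] by simp
    also have "\<dots> \<le> B * t 0" using t_le B(2) by simp
    finally show ?thesis by (simp add: partial)
  qed
  then have "summable t"
    by (intro summableI_nonneg_bounded[where x = "h x + B * t 0"] t_nonneg)
  then have "(\<lambda>r. B * t r) \<longlonglongrightarrow> 0"
    using summable_LIMSEQ_zero tendsto_mult_right_zero by blast
  then have "(\<lambda>r. h (y r)) \<longlonglongrightarrow> 0"
    by (rule tendsto_0_le[where K = 1]) (use h_le in \<open>auto intro!: always_eventually intro: order_trans[OF _ abs_ge_self]\<close>)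
  then have "(\<lambda>N. \<Sum>r<N. t r) \<longlonglongrightarrow> h x - 0"
    unfolding partial by (intro tendsto_diff tendsto_const)
  then show ?thesis by (simp add: sums_def t_def y_def)
qed

theorem theorem5p1:
  fixes P :: "real ^ 'n ^ 'n" and \<pi> x :: "real ^ 'n" and Z :: "real ^ 'n ^ 'n"
    and M :: "'a measure" and X :: "nat \<Rightarrow> 'a \<Rightarrow> 'n" and j :: 'n
  assumes "column_stochastic P"
    and "irreducible_chain P"
    and "invariant_distribution P \<pi>"
    and "Z = fundamental_matrix P \<pi>"
    and "prob_vector x"
    and "markov_chain M X P x"
  shows "enn2ereal (mean_first_visit_time M X j) =
           ereal (1 + (Z $ j $ j - (Z *v (P *v x)) $ j) / \<pi> $ j)"
proof -
  define S where "S v = (\<Sum>i\<in>UNIV. v $ i)" for v :: "real ^ 'n"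
  \<comment> \<open>The factors \<open>S v\<close> make the claimed expression linear in
    \<open>v\<close>; at \<open>x\<close> they equal 1.\<close>
  define h where "h v = S v + (Z $ j $ j * S v - (Z *v (P *v v)) $ j) / \<pi> $ j" for v
  define y where "y = unvisited_dist P x j"
  have x: "0 \<le> x $ i" for i
    using assms(5) by (simp add: prob_vector_def)
  have Sx: "S x = 1"
    using assms(5) by (simp add: prob_vector_def S_def)
  have pos: "\<pi> $ j \<noteq> 0"
    using invariant_distribution_pos[OF assms(1-3), of j] by simp
  have S: "linear S"
    by (rule linearI) (simp_all add: S_def sum.distrib sum_distrib_left)
  have h: "linear h"
    by (rule linearI)
       (simp_all add: h_def linear_add[OF S] linear_cmul[OF S] matrix_vector_right_distrib
         matrix_vector_mult_scaleR diff_divide_distrib add_divide_distrib algebra_simps)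
  have Poisson: "(Z *v v) $ j - (Z *v (P *v v)) $ j = v $ j - S v * \<pi> $ j" for v
    using arg_cong[OF fundamental_matrix_Poisson[OF assms(1-3), of v], of "\<lambda>u. u $ j"]
    by (simp add: assms(4) S_def)
  have step: "h (y r) = S (y r) + h (y (Suc r))" for r
  proof -
    define w where "w = P *v y r"
    \<comment> \<open>Discarding the mass at \<open>j\<close> subtracts a multiple of a unit vector,
      whose image under \<open>Z\<close> has entry \<open>Z $ j $ j\<close> at
      \<open>j\<close>.\<close>
    have y_Suc: "y (Suc r) = w - w $ j *s axis j 1"
      by (simp add: y_def w_def vec_eq_iff axis_def)
    have Sw: "S (y (Suc r)) = S w - w $ j"
      unfolding y_Suc linear_diff[OF S]
      by (simp add: S_def axis_def if_distrib cong: if_cong)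
    have Zw: "(Z *v y (Suc r)) $ j = (Z *v w) $ j - w $ j * Z $ j $ j"
      unfolding y_Suc
      by (simp add: matrix_vector_mult_diff_distrib vector_scalar_commute
          matrix_vector_mult_basis column_def)
    have yj: "y (Suc r) $ j = 0"
      by (simp add: y_def)
    \<comment> \<open>As \<open>y (Suc r)\<close> vanishes at \<open>j\<close>, the Poisson identity
      trades \<open>Z ** P\<close> for \<open>Z\<close> and cancels the summand
      \<open>S (y (Suc r))\<close>. The two terms with \<open>w $ j * Z $ j $ j\<close> cancel as
      well.\<close>
    have "h (y (Suc r)) = (Z $ j $ j * S w - (Z *v w) $ j) / \<pi> $ j"
      using Poisson[of "y (Suc r)"] pos by (simp add: h_def yj Sw Zw field_simps)
    moreover have "S w = S (y r)"
      unfolding S_def w_def using sum_column_stochastic_mult[OF assms(1)] .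
    ultimately show ?thesis
      by (simp add: h_def w_def)
  qed
  have sums: "(\<lambda>r. S (y r)) sums h x"
    unfolding S_def y_def
    by (rule sums_unvisited_dist[OF assms(1) x h]) (use step in \<open>simp add: S_def y_def\<close>)
  have nonneg: "0 \<le> S (y r)" for r
    unfolding S_def y_def by (intro sum_nonneg unvisited_dist_nonneg assms(1) x)
  have "mean_first_visit_time M X j = ennreal (h x)"
    using suminf_ennreal_eq[OF nonneg sums]
    by (simp add: mean_first_visit_time_eq_suminf[OF assms(6)] S_def y_def)
  \<comment> \<open>\<open>ennreal\<close> truncates negative reals to 0, so the sign is needed to
    recover \<open>h x\<close>.\<close>
  moreover have "0 \<le> h x"
    using sums_le[OF nonneg sums_zero sums] by simp
  ultimately show ?thesis
    by (simp add: enn2ereal_ennreal h_def Sx)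
qed

end
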